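(* Let $n,q,m,p$ be nonnegative integers, let $N:=\{1,2,\ldots,n\}$, and let $f:\mathbb{R}^n\times\mathbb{R}^q\to\mathbb{R}$, $g:\mathbb{R}^n\times\mathbb{R}^q\to\mathbb{R}^m$, $h:\mathbb{R}^n\times\mathbb{R}^q\to\mathbb{R}^p$ be arbitrary functions. Consider the binary nonlinear-optimization problem (BNLP) $$\min\{ f(x,y) \;:\; g(x,y)\le 0,\; h(x,y)=0,\; x\in\{0,1\}^n,\; y\in\mathbb{R}^q\},$$ and the Lagrangian dual (D) of its continuous relaxation, $$\max_{\lambda,\mu,\upsilon,\nu}\Big\{ \theta(\lambda,\mu,\upsilon,\nu) \;:\; \lambda\in\mathbb{R}^m,\ \mu\in\mathbb{R}^p,\ \upsilon,\nu\in\mathbb{R}^n,\ \lambda\ge 0,\ \upsilon\ge 0,\ \nu\ge 0\Big\},$$ where $$\theta(\lambda,\mu,\upsilon,\nu) := -\nu^{\top}\mathbf{e}+\inf_{(x,y)\in\mathbb{R}^n\times\mathbb{R}^q}\Big( f(x,y)+\lambda^{\top}g(x,y)+\mu^{\top}h(x,y)-(\upsilon-\nu)^{\top}x\Big).$$ Let $\mathrm{UB}$ be the objective-function value of a feasible solution of (BNLP), and let $(\hat\lambda,\hat\mu,\hat\upsilon,\hat\nu)$ be a feasible solution of (D) with objective-function value $\hat\zeta=\theta(\hat\lambda,\hat\mu,\hat\upsilon,\hat\nu)$. Then, for every optimal solution $(x^*,y^* )$ of (BNLP), we have: $$x_k^*=0 \quad \text{for all } k\in N \text{ such that } \mathrm{UB}-\hat\zeta<\hat\upsilon_k,$$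 $$x_k^*=1 \quad \text{for all } k\in N \text{ such that } \mathrm{UB}-\hat\zeta<\hat\nu_k.$$
   Context: Here $\mathbf{e}$ denotes the all-ones vector in $\mathbb{R}^n$, $0$ denotes a zero vector, and vector inequalities are componentwise. The continuous relaxation of (BNLP) is $\min\{f(x,y): g(x,y)\le 0,\ h(x,y)=0,\ 0\le x\le \mathbf{e}\}$ over $(x,y)\in\mathbb{R}^n\times\mathbb{R}^q$; in its Lagrangian dual, $\lambda,\mu,\upsilon,\nu$ are the multipliers of the constraints $g(x,y)\le 0$, $h(x,y)=0$, $x\ge 0$, $x\le\mathbf{e}$, respectively. No convexity or continuity is assumed. The infimum, and hence $\hat\zeta$, takes values in $\mathbb{R}\cup\{-\infty\}$; if $\hat\zeta=-\infty$ then $\mathrm{UB}-\hat\zeta=+\infty$. An optimal solution of (BNLP) is a feasible point whose objective value is at most that of every feasible point. *)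

theory Defs
  imports Jordan_Normal_Form.Matrix "HOL-Library.Extended_Real"
begin

text \<open>
  Vectors in $R^n$ are elements of \<open>carrier_vec n\<close>, so every dimension, including \<open>0\<close>, is
  covered. Components are indexed by \<open>{0..<n}\<close> rather than \<open>{1..n}\<close>. The order \<open>\<le>\<close> on vectors
  is the library's componentwise order, which also requires the two dimensions to agree.
\<close>

abbreviation ones_vec :: "nat \<Rightarrow> real vec" where
  "ones_vec n \<equiv> vec n (\<lambda>_. 1)"

definition bnlp_feasible ::
  "nat \<Rightarrow> nat \<Rightarrow> nat \<Rightarrow> nat \<Rightarrow> (real vec \<Rightarrow> real vec \<Rightarrow> real vec) \<Rightarrow>
   (real vec \<Rightarrow> real vec \<Rightarrow> real vec) \<Rightarrow> real vec \<Rightarrow> real vec \<Rightarrow> bool" where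
  "bnlp_feasible n q m p g h x y \<longleftrightarrow>
     x \<in> carrier_vec n \<and> (\<forall>i<n. x $ i \<in> {0, 1}) \<and> y \<in> carrier_vec q \<and>
     g x y \<le> 0\<^sub>v m \<and> h x y = 0\<^sub>v p"

definition bnlp_optimal ::
  "nat \<Rightarrow> nat \<Rightarrow> nat \<Rightarrow> nat \<Rightarrow> (real vec \<Rightarrow> real vec \<Rightarrow> real) \<Rightarrow> (real vec \<Rightarrow> real vec \<Rightarrow> real vec) \<Rightarrow>
   (real vec \<Rightarrow> real vec \<Rightarrow> real vec) \<Rightarrow> real vec \<Rightarrow> real vec \<Rightarrow> bool" where
  "bnlp_optimal n q m p f g h x y \<longleftrightarrow>
     bnlp_feasible n q m p g h x y \<and>
     (\<forall>x' y'. bnlp_feasible n q m p g h x' y' \<longrightarrow> f x y \<le> f x' y')"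

text \<open>
  The Lagrangian dual of the continuous relaxation
  $\min \{f(x,y) : g(x,y) \le 0,\ h(x,y) = 0,\ 0 \le x \le e\}$. The multipliers \<open>lam\<close>, \<open>mu\<close>, \<open>ups\<close>, \<open>nu\<close>
  belong to the constraints $g(x,y) \le 0$, $h(x,y) = 0$, $x \ge 0$, $x \le e$ respectively. The constant
  part of the term \<open>nu \<bullet> (x - e)\<close> is taken out of the infimum. The infimum is taken in \<open>ereal\<close>,
  so that it is $-\infty$ when the Lagrangian is unbounded below.
\<close>

definition dual_objective ::
  "nat \<Rightarrow> nat \<Rightarrow> (real vec \<Rightarrow> real vec \<Rightarrow> real) \<Rightarrow> (real vec \<Rightarrow> real vec \<Rightarrow> real vec) \<Rightarrow>
   (real vec \<Rightarrow> real vec \<Rightarrow> real vec) \<Rightarrow> real vec \<Rightarrow> real vec \<Rightarrow> real vec \<Rightarrow> real vec \<Rightarrow> ereal" where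
  "dual_objective n q f g h lam mu ups nu =
     ereal (- (nu \<bullet> ones_vec n)) +
     (INF (x, y) \<in> carrier_vec n \<times> carrier_vec q.
        ereal (f x y + lam \<bullet> g x y + mu \<bullet> h x y - (ups - nu) \<bullet> x))"

definition dual_feasible ::
  "nat \<Rightarrow> nat \<Rightarrow> nat \<Rightarrow> real vec \<Rightarrow> real vec \<Rightarrow> real vec \<Rightarrow> real vec \<Rightarrow> bool" where
  "dual_feasible n m p lam mu ups nu \<longleftrightarrow>
     lam \<in> carrier_vec m \<and> mu \<in> carrier_vec p \<and> ups \<in> carrier_vec n \<and> nu \<in> carrier_vec n \<and>
     0\<^sub>v m \<le> lam \<and> 0\<^sub>v n \<le> ups \<and> 0\<^sub>v n \<le> nu"

end

(*
  Weak duality with the slack kept: at a feasible (x, y) the Lagrangian is at most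
  f(x,y) - sum_i (ups_i x_i + nu_i (1 - x_i)), and every summand is nonnegative. At an optimal
  solution f <= UB, so each single summand is at most UB - zeta; x_k = 1 would give
  ups_k <= UB - zeta, and x_k = 0 would give nu_k <= UB - zeta.
*)
theory Submission
  imports Defs
begin

lemma less_eq_vec_index:
  fixes a b :: "'a :: ord vec"
  assumes "a \<le> b" and "i < dim_vec b"
  shows "a $ i \<le> b $ i"
  using assms unfolding less_eq_vec_def by blast

text \<open>Gives the sign of the term \<open>lam \<bullet> g x y\<close> of the Lagrangian. The
  vector order compares dimensions too, so both assumptions together fix the index range to
  \<open>m\<close>.\<close>

lemma scalar_prod_nonpos:
  fixes a b :: "real vec"
  assumes "0\<^sub>v m \<le> a" and "b \<le> 0\<^sub>v m"
  shows "a \<bullet> b \<le> 0"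
  unfolding scalar_prod_def
proof (intro sum_nonpos mult_nonneg_nonpos)
  fix i assume "i \<in> {0..<dim_vec b}"
  then have "i < m"
    using assms(2) by (simp add: less_eq_vec_def)
  moreover have "dim_vec a = m"
    using assms(1) by (simp add: less_eq_vec_def)
  ultimately show "0 \<le> a $ i" and "b $ i \<le> 0"
    using less_eq_vec_index[OF assms(1), of i] less_eq_vec_index[OF assms(2), of i] by simp_all
qed

text \<open>The infimum is at most the Lagrangian at the feasible pair itself. The terms of the
  bounds on \<open>x\<close> are kept as a sum over coordinates instead of being estimated by zero;
  this slack is what allows variables to be fixed.\<close>

lemma dual_objective_le:
  assumes feas: "bnlp_feasible n q m p g h x y"
    and dual: "dual_feasible n m p lam mu ups nu"
  shows "dual_objective n q f g h lam mu ups nu \<le>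
    ereal (f x y - (\<Sum>i<n. ups $ i * x $ i + nu $ i * (1 - x $ i)))"
proof -
  have x: "x \<in> carrier_vec n" and y: "y \<in> carrier_vec q"
    and g: "g x y \<le> 0\<^sub>v m" and h: "h x y = 0\<^sub>v p"
    using feas by (auto simp: bnlp_feasible_def)
  have lam: "0\<^sub>v m \<le> lam" and mu: "mu \<in> carrier_vec p"
    and ups: "ups \<in> carrier_vec n" and nu: "nu \<in> carrier_vec n"
    using dual by (auto simp: dual_feasible_def)
  have "nu \<bullet> ones_vec n = (\<Sum>i<n. nu $ i)"
    by (simp add: scalar_prod_def atLeast0LessThan)
  moreover have "(ups - nu) \<bullet> x = (\<Sum>i<n. (ups $ i - nu $ i) * x $ i)"
    using x ups nu by (simp add: scalar_prod_def atLeast0LessThan)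
  \<comment> \<open>Regrouped by coordinate, each multiplier is paired with the slack of its own
    bound: \<open>x $ i\<close> for the lower one, \<open>1 - x $ i\<close> for the upper
    one.\<close>
  ultimately have mult: "nu \<bullet> ones_vec n + (ups - nu) \<bullet> x =
      (\<Sum>i<n. ups $ i * x $ i + nu $ i * (1 - x $ i))"
    by (simp add: sum.distrib[symmetric] algebra_simps)
  have "dual_objective n q f g h lam mu ups nu \<le> ereal (- (nu \<bullet> ones_vec n)) +
      ereal (f x y + lam \<bullet> g x y + mu \<bullet> h x y - (ups - nu) \<bullet> x)"
    unfolding dual_objective_def using x y by (intro add_left_mono INF_lower2[of "(x, y)"]) auto
  \<comment> \<open>The \<open>mu\<close> term vanishes because \<open>h x y\<close> is the zero
    vector, and the \<open>lam\<close> term is nonpositive.\<close>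
  also have "\<dots> \<le> ereal (f x y - (\<Sum>i<n. ups $ i * x $ i + nu $ i * (1 - x $ i)))"
    using mult h mu scalar_prod_nonpos[OF lam g] by simp
  finally show ?thesis .
qed

text \<open>At a binary \<open>x\<close> each summand equals \<open>ups $ i\<close> or
  \<open>nu $ i\<close>, hence is nonnegative, so a single one is bounded by the whole sum.\<close>

lemma dual_objective_le_component:
  assumes feas: "bnlp_feasible n q m p g h x y"
    and dual: "dual_feasible n m p lam mu ups nu" and k: "k < n"
  shows "dual_objective n q f g h lam mu ups nu \<le>
    ereal (f x y - (ups $ k * x $ k + nu $ k * (1 - x $ k)))"
proof -
  have "0 \<le> ups $ i * x $ i + nu $ i * (1 - x $ i)" if "i < n" for i
  proof -
    have "x $ i = 0 \<or> x $ i = 1" "0 \<le> ups $ i" "0 \<le> nu $ i"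
      using feas dual that less_eq_vec_index[of "0\<^sub>v n" ups i]
        less_eq_vec_index[of "0\<^sub>v n" nu i]
      by (auto simp: bnlp_feasible_def dual_feasible_def)
    then show ?thesis by auto
  qed
  then have "ups $ k * x $ k + nu $ k * (1 - x $ k) \<le>
      (\<Sum>i<n. ups $ i * x $ i + nu $ i * (1 - x $ i))"
    using k by (intro member_le_sum) auto
  then show ?thesis
    by (intro order.trans[OF dual_objective_le[OF feas dual]]) simp
qed

theorem theorem1:
  fixes n q m p :: nat
    and f :: "real vec \<Rightarrow> real vec \<Rightarrow> real"
    and g h :: "real vec \<Rightarrow> real vec \<Rightarrow> real vec"
    and UB :: real and zeta :: ereal
    and xbar ybar lam mu ups nu xs ys :: "real vec"
  assumes "\<And>x y. x \<in> carrier_vec n \<Longrightarrow> y \<in> carrier_vec q \<Longrightarrow> g x y \<in> carrier_vec m"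
    and "\<And>x y. x \<in> carrier_vec n \<Longrightarrow> y \<in> carrier_vec q \<Longrightarrow> h x y \<in> carrier_vec p"
    and "bnlp_feasible n q m p g h xbar ybar" and "UB = f xbar ybar"
    and "dual_feasible n m p lam mu ups nu"
    and "zeta = dual_objective n q f g h lam mu ups nu"
    and "bnlp_optimal n q m p f g h xs ys"
  shows "(\<forall>k<n. ereal UB - zeta < ereal (ups $ k) \<longrightarrow> xs $ k = 0) \<and>
         (\<forall>k<n. ereal UB - zeta < ereal (nu $ k) \<longrightarrow> xs $ k = 1)"
proof -
  have feas: "bnlp_feasible n q m p g h xs ys" and le: "f xs ys \<le> UB"
    using assms(3,4,7) by (auto simp: bnlp_optimal_def)
  have bin: "xs $ k = 0 \<or> xs $ k = 1" if "k < n" for k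
    using feas that by (auto simp: bnlp_feasible_def)
  \<comment> \<open>The component bound excludes \<open>zeta\<close> being plus infinity; at minus
    infinity the right-hand side is plus infinity, and for real \<open>zeta\<close> the claim is a
    rearrangement using \<open>f xs ys \<le> UB\<close>.\<close>
  have gap: "ereal (ups $ k * xs $ k + nu $ k * (1 - xs $ k)) \<le> ereal UB - zeta" if "k < n" for k
    using dual_objective_le_component[OF feas assms(5) that, of f] le
    unfolding assms(6)[symmetric] by (cases zeta) auto
  show ?thesis
  proof (intro conjI allI impI)
    show "xs $ k = 0" if "k < n" "ereal UB - zeta < ereal (ups $ k)" for k
      using bin[OF that(1)] order.strict_trans1[OF gap[OF that(1)] that(2)] by auto
    show "xs $ k = 1" if "k < n" "ereal UB - zeta < ereal (nu $ k)" for k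
      using bin[OF that(1)] order.strict_trans1[OF gap[OF that(1)] that(2)] by auto
  qed
qed

end
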